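(* Let $\mathfrak{A}$ be an mp-residuated lattice. Then the pure spectrum $Spp(\mathfrak{A})$ is a Hausdorff space.
   Context: A residuated lattice is an algebra $\mathfrak{A}=(A;\vee,\wedge,\odot,\rightarrow,0,1)$ such that $(A;\vee,\wedge,0,1)$ is a bounded lattice, $(A;\odot,1)$ is a commutative monoid, and $x\odot y\leq z$ iff $x\leq y\rightarrow z$ for all $x,y,z\in A$. A filter of $\mathfrak{A}$ is a non-empty subset $F\subseteq A$ with $x\odot y\in F$ for all $x,y\in F$, and $x\vee y\in F$ for all $x\in F$, $y\in A$. For filters $F,G$, $F\veebar G$ is the filter generated by $F\cup G$. A prime filter is a proper filter $\mathfrak{p}$ that is meet-irreducible among filters (equivalently, $x\vee y\in\mathfrak{p}$ implies $x\in\mathfrak{p}$ or $y\in\mathfrak{p}$); a minimal prime filter is an inclusion-minimal prime filter. $\mathfrak{A}$ is mp if every prime filter contains a unique minimal prime filter. For $a\in A$, $a^{\perp}=\{b\in A\mid b\vee a=1\}$. For a filter $F$, $\sigma(F)$ is the intersection of all prime filters $\mathfrak{q}$ that are contained in some prime filter containing $F$ (the empty intersection being $A$); equivalently $\sigma(F)=\{a\in A\mid F\veebar a^{\perp}=A\}$. $F$ is pure if $\sigma(F)=F$; $\sigma(\mathfrak{A})$ denotes the set of pure filters. A proper pure filter $\mathfrak{p}$ is purely-prime if for all $F_1,F_2\in\sigma(\mathfrak{A})$, $F_1\cap F_2\subseteq\mathfrak{p}$ implies $F_1\subseteq\mathfrak{p}$ or $F_2\subseteq\mathfrak{p}$. $Spp(\mathfrak{A})$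 is the set of purely-prime filters; the pure spectrum is $Spp(\mathfrak{A})$ with the topology whose open sets are $d_{p}(F)=\{P\in Spp(\mathfrak{A})\mid F\nsubseteq P\}$, $F\in\sigma(\mathfrak{A})$. *)

theory Defs
  imports "HOL-Analysis.T1_Spaces"
begin

unbundle lattice_syntax

class residuated_lattice = bounded_lattice +
  fixes mul :: "'a \<Rightarrow> 'a \<Rightarrow> 'a"  (infixl \<open>\<odot>\<close> 75)
    and imp :: "'a \<Rightarrow> 'a \<Rightarrow> 'a"  (infixr \<open>\<rightarrow>\<close> 60)
  assumes mul_assoc: "(x \<odot> y) \<odot> z = x \<odot> (y \<odot> z)"
    and mul_commute: "x \<odot> y = y \<odot> x"
    and mul_top_right: "x \<odot> \<top> = x"
    and residuation: "x \<odot> y \<le> z \<longleftrightarrow> x \<le> y \<rightarrow> z"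
begin

definition rl_filter :: "'a set \<Rightarrow> bool" where
  "rl_filter F \<longleftrightarrow> F \<noteq> {} \<and> (\<forall>x\<in>F. \<forall>y\<in>F. x \<odot> y \<in> F) \<and> (\<forall>x\<in>F. \<forall>y. x \<squnion> y \<in> F)"

definition prime_filter :: "'a set \<Rightarrow> bool" where
  "prime_filter P \<longleftrightarrow> rl_filter P \<and> P \<noteq> UNIV \<and>
     (\<forall>F G. rl_filter F \<longrightarrow> rl_filter G \<longrightarrow> F \<inter> G = P \<longrightarrow> F = P \<or> G = P)"

definition minimal_prime_filter :: "'a set \<Rightarrow> bool" where
  "minimal_prime_filter M \<longleftrightarrow> prime_filter M \<and> (\<forall>Q. prime_filter Q \<longrightarrow> Q \<subseteq> M \<longrightarrow> Q = M)"

definition sigma :: "'a set \<Rightarrow> 'a set" where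
  "sigma F = \<Inter>{Q. prime_filter Q \<and> (\<exists>P. prime_filter P \<and> F \<subseteq> P \<and> Q \<subseteq> P)}"

definition pure_filter :: "'a set \<Rightarrow> bool" where
  "pure_filter F \<longleftrightarrow> rl_filter F \<and> sigma F = F"

definition purely_prime_filter :: "'a set \<Rightarrow> bool" where
  "purely_prime_filter P \<longleftrightarrow> pure_filter P \<and> P \<noteq> UNIV \<and>
     (\<forall>F G. pure_filter F \<longrightarrow> pure_filter G \<longrightarrow> F \<inter> G \<subseteq> P \<longrightarrow> F \<subseteq> P \<or> G \<subseteq> P)"

definition Spp :: "'a set set" where
  "Spp = {P. purely_prime_filter P}"

definition d_p :: "'a set \<Rightarrow> 'a set set" where
  "d_p F = {P \<in> Spp. \<not> F \<subseteq> P}"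

(* HOL-Analysis leaves topology unspecified off istopology; see istopology_pure_spectrum. *)
definition pure_spectrum :: "'a set topology" where
  "pure_spectrum = topology (\<lambda>U. \<exists>F. pure_filter F \<and> U = d_p F)"

lemma mul_sup_distrib: "x \<odot> (y \<squnion> z) = x \<odot> y \<squnion> x \<odot> z"
proof (rule order.antisym)
  have "y \<odot> x \<le> x \<odot> y \<squnion> x \<odot> z" "z \<odot> x \<le> x \<odot> y \<squnion> x \<odot> z"
    by (simp_all add: mul_commute)
  then have "y \<squnion> z \<le> x \<rightarrow> (x \<odot> y \<squnion> x \<odot> z)"
    by (simp add: residuation)
  then show "x \<odot> (y \<squnion> z) \<le> x \<odot> y \<squnion> x \<odot> z"
    by (metis residuation mul_commute)
  have "y \<squnion> z \<le> x \<rightarrow> x \<odot> (y \<squnion> z)"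
    by (metis residuation mul_commute order.refl)
  then show "x \<odot> y \<squnion> x \<odot> z \<le> x \<odot> (y \<squnion> z)"
    by (metis le_sup_iff residuation mul_commute)
qed

lemma mul_le_right: "x \<odot> y \<le> y"
proof -
  have "y \<odot> (x \<squnion> \<top>) = y \<odot> x \<squnion> y"
    by (simp only: mul_sup_distrib mul_top_right)
  then have "y = x \<odot> y \<squnion> y"
    by (simp only: mul_top_right sup_top_right mul_commute[of y x])
  then show ?thesis by (metis sup_ge1)
qed

lemma sup_mul_sup_le: "(x \<squnion> z) \<odot> (y \<squnion> z) \<le> x \<odot> y \<squnion> z"
proof -
  have "(x \<squnion> z) \<odot> (y \<squnion> z) = (x \<squnion> z) \<odot> y \<squnion> (x \<squnion> z) \<odot> z"
    by (rule mul_sup_distrib)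
  also have "(x \<squnion> z) \<odot> y = x \<odot> y \<squnion> y \<odot> z"
    by (metis mul_commute mul_sup_distrib)
  finally show ?thesis
    by (simp add: mul_le_right le_supI2)
qed

lemma rl_filter_upward: "rl_filter F \<Longrightarrow> x \<in> F \<Longrightarrow> x \<le> y \<Longrightarrow> y \<in> F"
  unfolding rl_filter_def by (metis sup.absorb2)

lemma rl_filter_top: "rl_filter F \<Longrightarrow> \<top> \<in> F"
  using rl_filter_upward top_greatest unfolding rl_filter_def by blast

lemma rl_filter_Inter:
  assumes "\<And>F. F \<in> \<F> \<Longrightarrow> rl_filter F"
  shows "rl_filter (\<Inter>\<F>)"
proof -
  have "\<top> \<in> \<Inter>\<F>" using assms rl_filter_top by blast
  then show ?thesis using assms unfolding rl_filter_def by blast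
qed

lemma rl_filter_Int: "rl_filter F \<Longrightarrow> rl_filter G \<Longrightarrow> rl_filter (F \<inter> G)"
  using rl_filter_Inter[of "{F, G}"] by auto

lemma prime_filter_sup:
  assumes P: "prime_filter P" and xy: "x \<squnion> y \<in> P"
  shows "x \<in> P \<or> y \<in> P"
proof -
  have fP: "rl_filter P" using P by (simp add: prime_filter_def)
  have residual: "rl_filter {z. \<forall>w\<in>S. z \<squnion> w \<in> P}" for S
    unfolding rl_filter_def
  proof (intro conjI ballI allI)
    show "{z. \<forall>w\<in>S. z \<squnion> w \<in> P} \<noteq> {}"
      using rl_filter_top[OF fP] by (auto intro: exI[of _ \<top>])
  next
    fix a b assume "a \<in> {z. \<forall>w\<in>S. z \<squnion> w \<in> P}" "b \<in> {z. \<forall>w\<in>S. z \<squnion> w \<in> P}"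
    then have "\<forall>w\<in>S. (a \<squnion> w) \<odot> (b \<squnion> w) \<in> P"
      using fP unfolding rl_filter_def by blast
    then show "a \<odot> b \<in> {z. \<forall>w\<in>S. z \<squnion> w \<in> P}"
      using rl_filter_upward[OF fP _ sup_mul_sup_le] by blast
  next
    fix a b assume a: "a \<in> {z. \<forall>w\<in>S. z \<squnion> w \<in> P}"
    show "a \<squnion> b \<in> {z. \<forall>w\<in>S. z \<squnion> w \<in> P}"
    proof (intro CollectI ballI)
      fix w assume "w \<in> S"
      with a have "a \<squnion> w \<in> P" by blast
      then show "a \<squnion> b \<squnion> w \<in> P"
        by (rule rl_filter_upward[OF fP]) (simp add: le_supI1)
    qed
  qed
  define G where "G = {z. \<forall>w\<in>{y}. z \<squnion> w \<in> P}"
  define H where "H = {z. \<forall>w\<in>G. z \<squnion> w \<in> P}"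
  have "P \<subseteq> G" "P \<subseteq> H" using fP by (auto simp: G_def H_def rl_filter_def)
  moreover have "G \<inter> H \<subseteq> P" by (auto simp: H_def dest: bspec)
  ultimately have "G \<inter> H = P" by blast
  moreover have "rl_filter G" "rl_filter H" unfolding G_def H_def by (rule residual)+
  ultimately have "G = P \<or> H = P" using P by (simp add: prime_filter_def)
  moreover have "x \<in> G" using xy by (simp add: G_def)
  moreover have "y \<in> H" by (simp add: H_def G_def sup_commute)
  ultimately show ?thesis by metis
qed

lemma prime_filter_Int_subset:
  assumes "prime_filter P" "rl_filter F" "rl_filter G" "F \<inter> G \<subseteq> P"
  shows "F \<subseteq> P \<or> G \<subseteq> P"
proof (rule ccontr)
  assume "\<not> (F \<subseteq> P \<or> G \<subseteq> P)"
  then obtain x y where xy: "x \<in> F" "x \<notin> P" "y \<in> G" "y \<notin> P" by blast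
  have "x \<squnion> y \<in> F" using assms(2) xy unfolding rl_filter_def by blast
  moreover have "x \<squnion> y \<in> G" using assms(3) xy sup_commute unfolding rl_filter_def by metis
  ultimately show False using assms prime_filter_sup xy by blast
qed

lemma prime_filter_exists:
  assumes F: "rl_filter F" and a: "a \<notin> F"
  shows "\<exists>P. prime_filter P \<and> F \<subseteq> P \<and> a \<notin> P"
proof -
  let ?A = "{G. rl_filter G \<and> F \<subseteq> G \<and> a \<notin> G}"
  have "\<exists>M\<in>?A. \<forall>X\<in>?A. M \<subseteq> X \<longrightarrow> X = M"
  proof (rule subset_Zorn_nonempty)
    show "?A \<noteq> {}" using F a by blast
  next
    fix C assume ne: "C \<noteq> {}" and C: "subset.chain ?A C"
    have sub: "C \<subseteq> ?A" and lin: "\<And>X Y. X \<in> C \<Longrightarrow> Y \<in> C \<Longrightarrow> X \<subseteq> Y \<or> Y \<subseteq> X"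
      using C by (auto simp: subset_chain_def)
    have "rl_filter (\<Union>C)"
      unfolding rl_filter_def
    proof (intro conjI ballI allI)
      show "\<Union>C \<noteq> {}" using ne sub F unfolding rl_filter_def by blast
    next
      fix x y assume "x \<in> \<Union>C" "y \<in> \<Union>C"
      then obtain X where "X \<in> C" "x \<in> X" "y \<in> X" using lin by blast
      then show "x \<odot> y \<in> \<Union>C" using sub unfolding rl_filter_def by blast
    next
      fix x y assume "x \<in> \<Union>C"
      then show "x \<squnion> y \<in> \<Union>C" using sub unfolding rl_filter_def by blast
    qed
    then show "\<Union>C \<in> ?A" using ne sub by blast
  qed
  then obtain P where P: "rl_filter P" "F \<subseteq> P" "a \<notin> P"
    and max: "\<And>X. rl_filter X \<Longrightarrow> P \<subseteq> X \<Longrightarrow> a \<notin> X \<Longrightarrow> X = P"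
    by auto
  have "prime_filter P"
    unfolding prime_filter_def
  proof (intro conjI allI impI)
    show "P \<noteq> UNIV" using P by blast
  next
    fix G H assume G: "rl_filter G" and H: "rl_filter H" and eq: "G \<inter> H = P"
    then have "a \<notin> G \<or> a \<notin> H" using P by blast
    then show "G = P \<or> H = P" using max[OF G] max[OF H] eq by blast
  qed (rule P)
  with P show ?thesis by blast
qed

lemma sigma_subset: "rl_filter F \<Longrightarrow> sigma F \<subseteq> F"
  unfolding sigma_def using prime_filter_exists by blast

lemma pure_filterI:
  assumes "rl_filter F"
    and "\<And>P Q. prime_filter P \<Longrightarrow> prime_filter Q \<Longrightarrow> F \<subseteq> P \<Longrightarrow> Q \<subseteq> P \<Longrightarrow> F \<subseteq> Q"
  shows "pure_filter F"
proof -
  have "F \<subseteq> sigma F" unfolding sigma_def using assms(2) by blast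
  with assms(1) show ?thesis using sigma_subset by (auto simp: pure_filter_def)
qed

lemma pure_filterD:
  assumes "pure_filter F" "prime_filter P" "prime_filter Q" "F \<subseteq> P" "Q \<subseteq> P"
  shows "F \<subseteq> Q"
proof -
  have "sigma F \<subseteq> Q" unfolding sigma_def using assms by blast
  with assms(1) show ?thesis by (simp add: pure_filter_def)
qed

lemma pure_filter_rl_filter: "pure_filter F \<Longrightarrow> rl_filter F"
  by (simp add: pure_filter_def)

lemma pure_filter_Int:
  assumes "pure_filter F" "pure_filter G"
  shows "pure_filter (F \<inter> G)"
proof (rule pure_filterI)
  fix P Q assume PQ: "prime_filter P" "prime_filter Q" "F \<inter> G \<subseteq> P" "Q \<subseteq> P"
  have "F \<subseteq> P \<or> G \<subseteq> P"
    using PQ(1) assms[THEN pure_filter_rl_filter] PQ(3) by (rule prime_filter_Int_subset)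
  then have "F \<subseteq> Q \<or> G \<subseteq> Q"
    using pure_filterD[OF assms(1) PQ(1,2) _ PQ(4)] pure_filterD[OF assms(2) PQ(1,2) _ PQ(4)]
    by argo
  then show "F \<inter> G \<subseteq> Q" by blast
qed (simp add: assms pure_filter_rl_filter rl_filter_Int)

lemma pure_filter_Sup:
  assumes "\<And>F. F \<in> \<F> \<Longrightarrow> pure_filter F"
  shows "pure_filter (\<Inter>{G. rl_filter G \<and> \<Union>\<F> \<subseteq> G})"
proof (rule pure_filterI)
  fix P Q
  assume PQ: "prime_filter P" "prime_filter Q" "\<Inter>{G. rl_filter G \<and> \<Union>\<F> \<subseteq> G} \<subseteq> P" "Q \<subseteq> P"
  then have "\<Union>\<F> \<subseteq> P" by blast
  then have "\<Union>\<F> \<subseteq> Q" using PQ assms pure_filterD by (meson Sup_le_iff)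
  moreover have "rl_filter Q" using PQ by (simp add: prime_filter_def)
  ultimately show "\<Inter>{G. rl_filter G \<and> \<Union>\<F> \<subseteq> G} \<subseteq> Q" by blast
qed (rule rl_filter_Inter, blast)

lemma pure_filter_UNIV: "pure_filter UNIV"
  by (rule pure_filterI) (auto simp: rl_filter_def prime_filter_def)

lemma istopology_pure_spectrum: "istopology (\<lambda>U. \<exists>F. pure_filter F \<and> U = d_p F)"
  unfolding istopology_def
proof (intro conjI allI impI)
  fix S T assume "\<exists>F. pure_filter F \<and> S = d_p F" "\<exists>G. pure_filter G \<and> T = d_p G"
  then obtain F G where FG: "pure_filter F" "S = d_p F" "pure_filter G" "T = d_p G" by blast
  then have "S \<inter> T = d_p (F \<inter> G)"
    by (auto simp: d_p_def Spp_def purely_prime_filter_def)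
  then show "\<exists>H. pure_filter H \<and> S \<inter> T = d_p H"
    using pure_filter_Int FG by blast
next
  fix \<K> assume K: "\<forall>K\<in>\<K>. \<exists>F. pure_filter F \<and> K = d_p F"
  define \<F> where "\<F> = {F. pure_filter F \<and> d_p F \<in> \<K>}"
  define J where "J = \<Inter>{G. rl_filter G \<and> \<Union>\<F> \<subseteq> G}"
  have J: "J \<subseteq> P \<longleftrightarrow> \<Union>\<F> \<subseteq> P" if "P \<in> Spp" for P
  proof -
    have "rl_filter P"
      using that by (simp add: Spp_def purely_prime_filter_def pure_filter_def)
    then show ?thesis unfolding J_def by blast
  qed
  have "\<K> = d_p ` \<F>" using K unfolding \<F>_def by auto
  then have "\<Union>\<K> = d_p J" using J by (auto simp: d_p_def)
  moreover have "pure_filter J" unfolding J_def \<F>_def by (rule pure_filter_Sup) blast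
  ultimately show "\<exists>F. pure_filter F \<and> \<Union>\<K> = d_p F" by blast
qed

lemma openin_pure_spectrum: "openin pure_spectrum U \<longleftrightarrow> (\<exists>F. pure_filter F \<and> U = d_p F)"
  unfolding pure_spectrum_def by (simp add: istopology_pure_spectrum)

lemma topspace_pure_spectrum: "topspace pure_spectrum = Spp"
proof -
  have "d_p UNIV = Spp" by (auto simp: d_p_def Spp_def purely_prime_filter_def)
  moreover have "d_p F \<subseteq> Spp" for F by (auto simp: d_p_def)
  ultimately show ?thesis
    unfolding topspace_def openin_pure_spectrum using pure_filter_UNIV by blast
qed

end

class mp_residuated_lattice = residuated_lattice +
  assumes unique_minimal_prime_filter:
    "prime_filter P \<Longrightarrow> \<exists>!M. minimal_prime_filter M \<and> M \<subseteq> P"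

unbundle no lattice_syntax

end

theory Submission
  imports Defs
begin

text \<open>
  In an mp-residuated lattice the purely-prime filters are minimal prime filters, and
  distinct minimal primes can be separated by pure filters.

  The element-wise form of the mp condition is: if \<open>x \<squnion> y = \<top>\<close>, then some \<open>u\<close> and \<open>v\<close> satisfy
  \<open>u \<squnion> x = \<top>\<close>, \<open>v \<squnion> y = \<top>\<close> and \<open>u \<odot> v = \<bottom>\<close>
  (lemma \<open>coprime_coannihilators\<close>). It is an interpolation property: applied to a witness of
  \<open>a \<in> sigma G\<close> it produces an element of \<open>sigma G\<close> that again witnesses \<open>a \<in> sigma (sigma G)\<close>, so
  \<open>sigma G\<close> is pure for every filter \<open>G\<close> (lemma \<open>pure_filter_sigma\<close>).

  Let \<open>M \<noteq> N\<close> be minimal primes. No prime contains both, so \<open>x \<odot> y = \<bottom>\<close> for some \<open>x \<in> M\<close> and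
  \<open>y \<in> N\<close>. The pure filters \<open>sigma (perp x)\<close> and \<open>sigma (perp y)\<close> are not contained in
  \<open>M\<close> and \<open>N\<close>, respectively. A prime that omits \<open>x\<close> contains \<open>perp x\<close>, hence \<open>sigma (perp x)\<close>; since
  every prime omits \<open>x\<close> or \<open>y\<close>, the two pure filters meet in \<open>\<top>\<close> only
  (lemma \<open>minimal_primes_separated\<close>).

  A purely-prime filter contains one of any two pure filters that meet in \<open>\<top>\<close>, so it lies in only one
  minimal prime; by purity it is the intersection of the minimal primes that contain it, so it equals
  that minimal prime. The separating pair of pure filters then gives disjoint open sets in the pure
  spectrum.
\<close>

unbundle lattice_syntax

section \<open>Coannihilators and the existence of prime filters\<close>

context residuated_lattice
begin

lemma prime_filter_rl_filter: "prime_filter P \<Longrightarrow> rl_filter P"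
  by (simp add: prime_filter_def)

lemma bot_notin_prime: "prime_filter P \<Longrightarrow> \<bottom> \<notin> P"
  unfolding prime_filter_def using rl_filter_upward[of P \<bottom>] by auto

lemma mul_in_filter: "rl_filter F \<Longrightarrow> x \<in> F \<Longrightarrow> y \<in> F \<Longrightarrow> x \<odot> y \<in> F"
  by (simp add: rl_filter_def)

lemma bot_product_notin_prime:
  assumes "prime_filter P" "x \<odot> y = \<bottom>" "x \<in> P"
  shows "y \<notin> P"
  using assms mul_in_filter[OF prime_filter_rl_filter] bot_notin_prime by metis

lemma top_join_in_prime:
  assumes "prime_filter P" "x \<squnion> y = \<top>" "x \<notin> P"
  shows "y \<in> P"
  using assms prime_filter_sup[of P x y] rl_filter_top[OF prime_filter_rl_filter] by auto

lemma mul_mono: "x \<le> x' \<Longrightarrow> y \<le> y' \<Longrightarrow> x \<odot> y \<le> x' \<odot> y'"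
proof -
  have mono: "z \<odot> s \<le> z \<odot> t" if "s \<le> t" for z s t
    using mul_sup_distrib[of z s t] that by (metis sup.absorb2 sup_ge1)
  assume "x \<le> x'" "y \<le> y'"
  then have "x \<odot> y \<le> x \<odot> y'" "y' \<odot> x \<le> y' \<odot> x'" by (simp_all add: mono)
  then show ?thesis by (metis mul_commute order.trans)
qed

text \<open>The coannihilator of \<open>a\<close>.\<close>

definition perp :: "'a \<Rightarrow> 'a set" where
  "perp a = {b. b \<squnion> a = \<top>}"

lemma rl_filter_perp: "rl_filter (perp a)"
  unfolding rl_filter_def perp_def
proof (intro conjI ballI allI)
  show "{b. b \<squnion> a = \<top>} \<noteq> {}" by (auto intro: exI[of _ \<top>])
next
  fix b c assume "b \<in> {b. b \<squnion> a = \<top>}" "c \<in> {b. b \<squnion> a = \<top>}"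
  then have "(b \<squnion> a) \<odot> (c \<squnion> a) = \<top>" by (simp add: mul_top_right)
  then show "b \<odot> c \<in> {b. b \<squnion> a = \<top>}"
    using sup_mul_sup_le[of b a c] by (simp add: top_unique)
next
  fix b c assume "b \<in> {b. b \<squnion> a = \<top>}"
  moreover have "b \<squnion> c \<squnion> a = (b \<squnion> a) \<squnion> c"
    by (simp only: sup.assoc sup.commute[of c a])
  ultimately show "b \<squnion> c \<in> {b. b \<squnion> a = \<top>}" by simp
qed

text \<open>
  Maximality of a filter that avoids \<open>S\<close> makes it meet-irreducible: two strictly larger filters both
  meet \<open>S\<close>, and the join of the two elements is in their intersection and in \<open>S\<close>.
\<close>

lemma prime_filter_avoiding:
  assumes F: "rl_filter F" and disj: "F \<inter> S = {}" and "S \<noteq> {}"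
    and join: "\<And>s t. s \<in> S \<Longrightarrow> t \<in> S \<Longrightarrow> s \<squnion> t \<in> S"
  shows "\<exists>P. prime_filter P \<and> F \<subseteq> P \<and> P \<inter> S = {}"
proof -
  let ?A = "{G. rl_filter G \<and> F \<subseteq> G \<and> G \<inter> S = {}}"
  have "\<exists>M\<in>?A. \<forall>X\<in>?A. M \<subseteq> X \<longrightarrow> X = M"
  proof (rule subset_Zorn_nonempty)
    show "?A \<noteq> {}" using F disj by blast
  next
    fix C assume ne: "C \<noteq> {}" and C: "subset.chain ?A C"
    have sub: "C \<subseteq> ?A" and lin: "\<And>X Y. X \<in> C \<Longrightarrow> Y \<in> C \<Longrightarrow> X \<subseteq> Y \<or> Y \<subseteq> X"
      using C by (auto simp: subset_chain_def)
    have "rl_filter (\<Union>C)"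
      unfolding rl_filter_def
    proof (intro conjI ballI allI)
      show "\<Union>C \<noteq> {}" using ne sub F unfolding rl_filter_def by blast
    next
      fix x y assume "x \<in> \<Union>C" "y \<in> \<Union>C"
      then obtain X where "X \<in> C" "x \<in> X" "y \<in> X" using lin by blast
      then show "x \<odot> y \<in> \<Union>C" using sub unfolding rl_filter_def by blast
    next
      fix x y assume "x \<in> \<Union>C"
      then show "x \<squnion> y \<in> \<Union>C" using sub unfolding rl_filter_def by blast
    qed
    then show "\<Union>C \<in> ?A" using ne sub by blast
  qed
  then obtain P where P: "rl_filter P" "F \<subseteq> P" "P \<inter> S = {}"
    and max: "\<And>X. rl_filter X \<Longrightarrow> P \<subseteq> X \<Longrightarrow> X \<inter> S = {} \<Longrightarrow> X = P"
    by auto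
  have "prime_filter P"
    unfolding prime_filter_def
  proof (intro conjI allI impI)
    show "P \<noteq> UNIV" using P \<open>S \<noteq> {}\<close> by blast
  next
    fix G H assume G: "rl_filter G" and H: "rl_filter H" and eq: "G \<inter> H = P"
    have "G \<inter> S = {} \<or> H \<inter> S = {}"
    proof (rule ccontr)
      assume "\<not> ?thesis"
      then obtain s t where st: "s \<in> G" "s \<in> S" "t \<in> H" "t \<in> S" by blast
      have "s \<squnion> t \<in> G" using G st unfolding rl_filter_def by blast
      moreover have "s \<squnion> t \<in> H"
        using H st(3) unfolding rl_filter_def by (metis sup_commute)
      ultimately show False using join[OF st(2,4)] eq P(3) by blast
    qed
    then show "G = P \<or> H = P" using max[OF G] max[OF H] eq by blast
  qed (rule P)
  with P show ?thesis by blast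
qed

text \<open>
  Passing to a smaller prime that omits \<open>a\<close> is a localisation at \<open>P\<close>: the joins of \<open>a\<close> with elements
  outside \<open>P\<close> form a join-closed set, and it does not contain \<open>\<top>\<close> exactly because \<open>perp a \<subseteq> P\<close>.
\<close>

lemma smaller_prime_omitting:
  assumes P: "prime_filter P" and a: "perp a \<subseteq> P"
  shows "\<exists>Q. prime_filter Q \<and> Q \<subseteq> P \<and> a \<notin> Q"
proof -
  define S where "S = {a \<squnion> y | y. y \<notin> P}"
  have "\<exists>Q. prime_filter Q \<and> {\<top>} \<subseteq> Q \<and> Q \<inter> S = {}"
  proof (rule prime_filter_avoiding)
    show "rl_filter {\<top>}" by (simp add: rl_filter_def mul_top_right)
    show "{\<top>} \<inter> S = {}" using a by (auto simp: S_def perp_def sup_commute)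
    show "S \<noteq> {}" using bot_notin_prime[OF P] by (auto simp: S_def)
  next
    fix s t assume "s \<in> S" "t \<in> S"
    then obtain y z where yz: "s = a \<squnion> y" "y \<notin> P" "t = a \<squnion> z" "z \<notin> P"
      by (auto simp: S_def)
    then have "s \<squnion> t = a \<squnion> (y \<squnion> z)" "y \<squnion> z \<notin> P"
      using prime_filter_sup[OF P] by (auto simp: sup.assoc sup.left_commute)
    then show "s \<squnion> t \<in> S" by (auto simp: S_def)
  qed
  then obtain Q where Q: "prime_filter Q" "Q \<inter> S = {}" by blast
  have "a \<squnion> y \<notin> Q" if "y \<notin> P" for y
    using Q(2) that by (auto simp: S_def)
  moreover have "a \<squnion> y \<in> Q" if "a \<in> Q \<or> y \<in> Q" for y
    using that rl_filter_upward[OF prime_filter_rl_filter[OF Q(1)]] sup_ge1 sup_ge2 by blast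
  ultimately have "Q \<subseteq> P" "a \<notin> Q"
    using bot_notin_prime[OF P] by blast+
  with Q(1) show ?thesis by blast
qed

text \<open>
  Otherwise localisation would give a prime inside \<open>M\<close> that omits \<open>x\<close>, against minimality.
\<close>

lemma perp_not_subset_minimal_prime:
  assumes M: "minimal_prime_filter M" and x: "x \<in> M"
  shows "\<not> perp x \<subseteq> M"
proof
  assume "perp x \<subseteq> M"
  then obtain Q where "prime_filter Q" "Q \<subseteq> M" "x \<notin> Q"
    using smaller_prime_omitting M unfolding minimal_prime_filter_def by blast
  then show False using M x unfolding minimal_prime_filter_def by blast
qed

text \<open>
  Without such elements, the upward closure of the products of \<open>F\<close> and \<open>G\<close> is a proper filter, and
  any prime above it contains both \<open>F\<close> and \<open>G\<close>.
\<close>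

lemma coprime_filters:
  assumes F: "rl_filter F" and G: "rl_filter G"
    and no_prime: "\<And>P. prime_filter P \<Longrightarrow> F \<subseteq> P \<Longrightarrow> G \<subseteq> P \<Longrightarrow> False"
  shows "\<exists>x\<in>F. \<exists>y\<in>G. x \<odot> y = \<bottom>"
proof (rule ccontr)
  assume none: "\<not> ?thesis"
  define H where "H = {z. \<exists>x\<in>F. \<exists>y\<in>G. x \<odot> y \<le> z}"
  have "F \<subseteq> H"
  proof
    fix x assume "x \<in> F"
    moreover have "x \<odot> \<top> \<le> x" by (simp add: mul_top_right)
    ultimately show "x \<in> H" using rl_filter_top[OF G] unfolding H_def by blast
  qed
  moreover have "G \<subseteq> H"
    using rl_filter_top[OF F] mul_le_right unfolding H_def by blast
  ultimately have sub: "F \<subseteq> H" "G \<subseteq> H" by blast+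
  have "rl_filter H"
    unfolding rl_filter_def
  proof (intro conjI ballI allI)
    show "H \<noteq> {}" using sub F unfolding rl_filter_def by blast
  next
    fix z w assume "z \<in> H" "w \<in> H"
    then obtain x y x' y' where xy: "x \<in> F" "y \<in> G" "x \<odot> y \<le> z"
      "x' \<in> F" "y' \<in> G" "x' \<odot> y' \<le> w" unfolding H_def by blast
    have "(x \<odot> x') \<odot> (y \<odot> y') = (x \<odot> y) \<odot> (x' \<odot> y')"
      by (metis mul_assoc mul_commute)
    also have "\<dots> \<le> z \<odot> w" using xy by (simp add: mul_mono)
    finally show "z \<odot> w \<in> H"
      using mul_in_filter[OF F xy(1,4)] mul_in_filter[OF G xy(2,5)] unfolding H_def by blast
  next
    fix z w assume "z \<in> H"
    then show "z \<squnion> w \<in> H" unfolding H_def using le_supI1 by blast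
  qed
  moreover have "\<bottom> \<notin> H" using none unfolding H_def by (auto simp: bot_unique)
  ultimately obtain P where "prime_filter P" "H \<subseteq> P"
    using prime_filter_exists by blast
  then show False using no_prime sub by blast
qed

lemma rl_filter_sigma: "rl_filter (sigma F)"
  unfolding sigma_def by (rule rl_filter_Inter) (auto simp: prime_filter_rl_filter)

text \<open>
  This is the description of \<open>sigma G\<close> as the set of all \<open>a\<close> such that \<open>G\<close> and \<open>perp a\<close> generate
  the whole lattice: such \<open>a\<close> are exactly those that belong to every prime below a prime above \<open>G\<close>,
  by localisation.
\<close>

lemma in_sigma_iff:
  assumes G: "rl_filter G"
  shows "a \<in> sigma G \<longleftrightarrow> (\<exists>g\<in>G. \<exists>c\<in>perp a. g \<odot> c = \<bottom>)"
proof
  assume a: "a \<in> sigma G"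
  show "\<exists>g\<in>G. \<exists>c\<in>perp a. g \<odot> c = \<bottom>"
  proof (rule coprime_filters[OF G rl_filter_perp])
    fix P assume P: "prime_filter P" "G \<subseteq> P" "perp a \<subseteq> P"
    then show False using smaller_prime_omitting a unfolding sigma_def by blast
  qed
next
  assume "\<exists>g\<in>G. \<exists>c\<in>perp a. g \<odot> c = \<bottom>"
  then obtain g c where gc: "g \<in> G" "c \<squnion> a = \<top>" "g \<odot> c = \<bottom>"
    by (auto simp: perp_def)
  show "a \<in> sigma G"
    unfolding sigma_def
  proof clarify
    fix Q P assume PQ: "prime_filter Q" "prime_filter P" "G \<subseteq> P" "Q \<subseteq> P"
    then have "c \<notin> Q" using bot_product_notin_prime gc by blast
    then show "a \<in> Q" using top_join_in_prime PQ(1) gc(2) by blast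
  qed
qed

end

section \<open>Pure filters and the separation of minimal primes\<close>

context mp_residuated_lattice
begin

text \<open>
  A prime containing both coannihilators would contain a prime omitting \<open>x\<close> and a prime omitting \<open>y\<close>.
  The unique minimal prime below it lies in both of these, so it omits \<open>x\<close> and \<open>y\<close> although it
  contains \<open>x \<squnion> y\<close>.
\<close>

lemma coprime_coannihilators:
  assumes xy: "x \<squnion> y = \<top>"
  shows "\<exists>u\<in>perp x. \<exists>v\<in>perp y. u \<odot> v = \<bottom>"
proof (rule coprime_filters[OF rl_filter_perp rl_filter_perp])
  fix P assume P: "prime_filter P" "perp x \<subseteq> P" "perp y \<subseteq> P"
  obtain Q where Q: "prime_filter Q" "Q \<subseteq> P" "x \<notin> Q"
    using smaller_prime_omitting P by blast
  obtain R where R: "prime_filter R" "R \<subseteq> P" "y \<notin> R"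
    using smaller_prime_omitting P by blast
  obtain M where M: "minimal_prime_filter M" "M \<subseteq> Q"
    using unique_minimal_prime_filter[OF Q(1)] by blast
  obtain N where N: "minimal_prime_filter N" "N \<subseteq> R"
    using unique_minimal_prime_filter[OF R(1)] by blast
  have "M \<subseteq> P" "N \<subseteq> P" using M(2) N(2) Q(2) R(2) by simp_all
  then have "M = N" using ex1E[OF unique_minimal_prime_filter[OF P(1)]] M(1) N(1) by metis
  then have "x \<notin> M" "y \<notin> M" using M N Q R by auto
  then show False
    using M(1) top_join_in_prime[OF _ xy] unfolding minimal_prime_filter_def by blast
qed

text \<open>
  If \<open>c\<close> is a witness of \<open>a \<in> sigma G\<close>, the interpolating \<open>u\<close> is in \<open>sigma G\<close> with the same witness,
  and \<open>v\<close> is a witness of \<open>a\<close> being in \<open>sigma\<close> of any filter containing \<open>u\<close>.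
\<close>

lemma pure_filter_sigma:
  assumes G: "rl_filter G"
  shows "pure_filter (sigma G)"
proof (rule pure_filterI[OF rl_filter_sigma])
  fix P Q assume PQ: "prime_filter P" "prime_filter Q" "sigma G \<subseteq> P" "Q \<subseteq> P"
  show "sigma G \<subseteq> Q"
  proof
    fix a assume "a \<in> sigma G"
    then obtain g c where gc: "g \<in> G" "c \<in> perp a" "g \<odot> c = \<bottom>"
      using in_sigma_iff[OF G] by blast
    obtain u v where uv: "u \<in> perp c" "v \<in> perp a" "u \<odot> v = \<bottom>"
      using coprime_coannihilators[of c a] gc(2) by (auto simp: perp_def)
    have "c \<in> perp u" using uv(1) by (simp add: perp_def sup_commute)
    then have "u \<in> P" using gc in_sigma_iff[OF G] PQ(3) by blast
    then have "v \<notin> Q" using bot_product_notin_prime[OF PQ(1) uv(3)] PQ(4) by blast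
    then show "a \<in> Q" using top_join_in_prime[OF PQ(2)] uv(2) by (simp add: perp_def)
  qed
qed

text \<open>
  By minimality \<open>perp x\<close> has an element \<open>b\<close> outside \<open>M\<close>. Interpolation between \<open>x\<close> and \<open>b\<close>
  shows that \<open>b\<close> survives the passage from \<open>perp x\<close> to the smaller filter \<open>sigma (perp x)\<close>.
\<close>

lemma sigma_perp_not_subset_minimal_prime:
  assumes M: "minimal_prime_filter M" and x: "x \<in> M"
  shows "\<not> sigma (perp x) \<subseteq> M"
proof -
  obtain b where b: "b \<in> perp x" "b \<notin> M"
    using perp_not_subset_minimal_prime[OF assms] by blast
  then have "\<exists>u\<in>perp x. \<exists>v\<in>perp b. u \<odot> v = \<bottom>"
    using coprime_coannihilators[of x b] by (simp add: perp_def sup_commute)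
  then have "b \<in> sigma (perp x)" by (simp add: in_sigma_iff rl_filter_perp)
  with b(2) show ?thesis by blast
qed

lemma sigma_perp_subset_prime:
  assumes "prime_filter P" "x \<notin> P"
  shows "sigma (perp x) \<subseteq> P"
proof -
  have "perp x \<subseteq> P"
    using top_join_in_prime[OF assms(1) _ assms(2)] by (auto simp: perp_def sup_commute)
  then show ?thesis using sigma_subset[OF rl_filter_perp] by blast
qed

lemma minimal_primes_separated:
  assumes M: "minimal_prime_filter M" and N: "minimal_prime_filter N" and "M \<noteq> N"
  shows "\<exists>F G. pure_filter F \<and> pure_filter G \<and> \<not> F \<subseteq> M \<and> \<not> G \<subseteq> N \<and> F \<inter> G \<subseteq> {\<top>}"
proof -
  have "rl_filter M" "rl_filter N"
    using M N by (auto simp: minimal_prime_filter_def prime_filter_rl_filter)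
  then have "\<exists>x\<in>M. \<exists>y\<in>N. x \<odot> y = \<bottom>"
    by (rule coprime_filters) (use assms unique_minimal_prime_filter in blast)
  then obtain x y where xy: "x \<in> M" "y \<in> N" "x \<odot> y = \<bottom>" by blast
  have "a = \<top>" if a: "a \<in> sigma (perp x) \<inter> sigma (perp y)" for a
  proof (rule ccontr)
    assume "a \<noteq> \<top>"
    moreover have "rl_filter {\<top>}" by (simp add: rl_filter_def mul_top_right)
    ultimately obtain P where P: "prime_filter P" "a \<notin> P"
      using prime_filter_exists[of "{\<top>}" a] by blast
    have "x \<notin> P \<or> y \<notin> P" using bot_product_notin_prime[OF P(1) xy(3)] by blast
    then show False using sigma_perp_subset_prime[OF P(1)] a P(2) by blast
  qed
  then have "sigma (perp x) \<inter> sigma (perp y) \<subseteq> {\<top>}" by blast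
  moreover have "\<not> sigma (perp x) \<subseteq> M" "\<not> sigma (perp y) \<subseteq> N"
    using sigma_perp_not_subset_minimal_prime M N xy by blast+
  moreover have "pure_filter (sigma (perp x))" "pure_filter (sigma (perp y))"
    by (simp_all add: pure_filter_sigma rl_filter_perp)
  ultimately show ?thesis by blast
qed

lemma pure_filter_subset_minimal_prime:
  assumes F: "pure_filter F" and P: "prime_filter P" "F \<subseteq> P"
  shows "\<exists>M. minimal_prime_filter M \<and> M \<subseteq> P \<and> F \<subseteq> M"
proof -
  obtain M where M: "minimal_prime_filter M" "M \<subseteq> P"
    using unique_minimal_prime_filter[OF P(1)] by blast
  then show ?thesis
    using pure_filterD[OF F P(1) _ P(2) M(2)] unfolding minimal_prime_filter_def by blast
qed

section \<open>Purely-prime filters and the pure spectrum\<close>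

text \<open>
  Two minimal primes above \<open>P\<close> would be separated by pure filters meeting in \<open>\<top>\<close>, and \<open>P\<close>, being
  purely-prime, contains one of these. So there is just one minimal prime above \<open>P\<close>, and, by purity
  of \<open>P\<close>, every prime above \<open>P\<close> lies above that minimal prime.
\<close>

lemma purely_prime_imp_minimal_prime:
  assumes P: "purely_prime_filter P"
  shows "minimal_prime_filter P"
proof -
  have pure: "pure_filter P" and "P \<noteq> UNIV"
    using P by (simp_all add: purely_prime_filter_def)
  note filter = pure_filter_rl_filter[OF pure]
  obtain a where "a \<notin> P" using \<open>P \<noteq> UNIV\<close> by blast
  then obtain Q where "prime_filter Q" "P \<subseteq> Q"
    using prime_filter_exists[OF filter] by blast
  then obtain M where M: "minimal_prime_filter M" "P \<subseteq> M"
    using pure_filter_subset_minimal_prime[OF pure] by blast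
  have unique: "N = M" if N: "minimal_prime_filter N" "P \<subseteq> N" for N
  proof (rule ccontr)
    assume "N \<noteq> M"
    then obtain F G where FG: "pure_filter F" "pure_filter G" "\<not> F \<subseteq> N" "\<not> G \<subseteq> M"
      "F \<inter> G \<subseteq> {\<top>}"
      using minimal_primes_separated[OF N(1) M(1)] by blast
    then have "F \<inter> G \<subseteq> P" using rl_filter_top[OF filter] by blast
    then have "F \<subseteq> P \<or> G \<subseteq> P" using P FG(1,2) by (simp add: purely_prime_filter_def)
    then show False using FG(3,4) M(2) N(2) by blast
  qed
  have "M \<subseteq> P"
  proof (rule ccontr)
    assume "\<not> M \<subseteq> P"
    then obtain a where "a \<in> M" "a \<notin> P" by blast
    then obtain Q where Q: "prime_filter Q" "P \<subseteq> Q" "a \<notin> Q"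
      using prime_filter_exists[OF filter] by blast
    then have "M \<subseteq> Q"
      using pure_filter_subset_minimal_prime[OF pure] unique by blast
    with \<open>a \<in> M\<close> Q(3) show False by blast
  qed
  with M show ?thesis by simp
qed

end

theorem corollary4p17:
  shows "Hausdorff_space (pure_spectrum :: 'a::mp_residuated_lattice set topology)"
  unfolding Hausdorff_space_def topspace_pure_spectrum
proof (intro allI impI, elim conjE)
  fix P Q :: "'a set" assume PQ: "P \<in> Spp" "Q \<in> Spp" "P \<noteq> Q"
  then have "minimal_prime_filter P" "minimal_prime_filter Q"
    by (simp_all add: Spp_def purely_prime_imp_minimal_prime)
  then obtain F G where FG: "pure_filter F" "pure_filter G" "\<not> F \<subseteq> P" "\<not> G \<subseteq> Q"
    "F \<inter> G \<subseteq> {\<top>}"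
    using minimal_primes_separated PQ(3) by blast
  have "F \<subseteq> R \<or> G \<subseteq> R" if "R \<in> Spp" for R
  proof -
    have R: "purely_prime_filter R" using that by (simp add: Spp_def)
    then have "F \<inter> G \<subseteq> R"
      using FG(5) rl_filter_top[OF pure_filter_rl_filter] by (auto simp: purely_prime_filter_def)
    with R FG(1,2) show ?thesis by (simp add: purely_prime_filter_def)
  qed
  then have "disjnt (d_p F) (d_p G)" by (auto simp: disjnt_def d_p_def)
  moreover have "P \<in> d_p F" "Q \<in> d_p G" using PQ FG by (auto simp: d_p_def)
  moreover have "openin pure_spectrum (d_p F)" "openin pure_spectrum (d_p G)"
    using FG by (auto simp: openin_pure_spectrum)
  ultimately show "\<exists>U V. openin pure_spectrum U \<and> openin pure_spectrum V \<and>
      P \<in> U \<and> Q \<in> V \<and> disjnt U V"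
    by blast
qed

end
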